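(* Let $f:\mathbb{C}^n\to\mathbb{C}^N$ be a polynomial map that restricts to a proper map $\mathbb{B}^n\to\mathbb{B}^N$. Let $A\subseteq\mathbb{C}^N$ be the subspace spanned by the coefficient vectors of the lowest order part of $f$. Write $Ef=E_{A,z}f=\big((\pi_A f)\otimes z\big)\oplus(1-\pi_A)f$. Then $$\Gamma_f\cap\mathbf{U}(n)\subseteq\Gamma_{Ef}.$$
   Context: $\mathbb{B}^n$ is the open unit ball of $\mathbb{C}^n$, $\mathrm{Aut}(\mathbb{B}^n)$ is its group of holomorphic automorphisms, and $\mathbf{U}(n)\leqslant\mathrm{Aut}(\mathbb{B}^n)$ is the unitary group. For a rational proper map $f:\mathbb{B}^n\to\mathbb{B}^N$, the Hermitian invariant group is $$\Gamma_f=\{\gamma\in\mathrm{Aut}(\mathbb{B}^n):\ \text{there is } \psi\in\mathrm{Aut}(\mathbb{B}^N)\text{ with } f\circ\gamma=\psi\circ f\}.$$ Write $f=\sum_{j=\nu}^d f_j$ with $f_j$ vector-valued and homogeneous of degree $j$, and $f_\nu\neq 0$; the lowest order part of $f$ is $f_\nu=\sum_{|\alpha|=\nu}A_\alpha z^\alpha$, with coefficient vectors $A_\alpha\in\mathbb{C}^N$. $\pi_A$ is orthogonal projection of $\mathbb{C}^N$ onto $A$. The map $Ef$ takes values in $(A\otimes\mathbb{C}^n)\oplus A^\perp$ (orthogonal sum, identified with a complex Euclidean space), where $((\pi_Af)\otimes z)$ is the map $z\mapsto (\pi_Af(z))\otimes z$; it is again a polynomial proper map between unit balls. *)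

theory Defs
  imports "HOL-Analysis.Analysis" "HOL-Library.Poly_Mapping"
begin

section \<open>Hermitian linear algebra in complex Euclidean space\<close>

text \<open>The real inner product of \<^typ>\<open>complex ^ 'm\<close> is the real part of the Hermitian one,
  so \<^const>\<open>norm\<close> and \<^const>\<open>ball\<close> already have their usual meaning in complex Euclidean space.
  Complex scalar multiplication is \<open>(*s)\<close>, and \<open>vec.span\<close>, \<open>vec.subspace\<close> are the span and
  subspace notions over the complex field.\<close>

definition herm :: "complex ^ 'm \<Rightarrow> complex ^ 'm \<Rightarrow> complex"
  where "herm x y = (\<Sum>i\<in>UNIV. x $ i * cnj (y $ i))"

definition orth_compl :: "(complex ^ 'm) set \<Rightarrow> (complex ^ 'm) set"
  where "orth_compl A = {y. \<forall>a\<in>A. herm y a = 0}"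

definition orth_proj :: "(complex ^ 'm) set \<Rightarrow> complex ^ 'm \<Rightarrow> complex ^ 'm"
  where "orth_proj A x = (THE y. y \<in> A \<and> x - y \<in> orth_compl A)"

definition conj_transpose :: "complex ^ 'm ^ 'm \<Rightarrow> complex ^ 'm ^ 'm"
  where "conj_transpose U = (\<chi> i j. cnj (U $ j $ i))"

definition unitary_matrix :: "complex ^ 'm ^ 'm \<Rightarrow> bool"
  where "unitary_matrix U \<longleftrightarrow> conj_transpose U ** U = mat 1 \<and> U ** conj_transpose U = mat 1"


section \<open>Automorphisms of balls and the Hermitian invariant group\<close>

text \<open>\<open>S\<close> will be an open subset of a complex subspace. Outside the subspace the derivative is not
  determined; a complex linear derivative along the subspace always extends complex linearly.\<close>

definition holomorphic_map_on :: "(complex ^ 'm \<Rightarrow> complex ^ 'k) \<Rightarrow> (complex ^ 'm) set \<Rightarrow> bool"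
  where "holomorphic_map_on f S \<longleftrightarrow>
    (\<forall>x\<in>S. \<exists>D. (f has_derivative D) (at x within S) \<and> (\<forall>c v. D (c *s v) = c *s D v))"

definition unit_ball :: "(complex ^ 'm) set \<Rightarrow> (complex ^ 'm) set"
  where "unit_ball W = ball 0 1 \<inter> W"

text \<open>The holomorphic automorphism group of the unit ball of a complex subspace \<open>W\<close>. For
  \<open>W = UNIV\<close> this is the automorphism group of the unit ball of \<^typ>\<open>complex ^ 'm\<close>.
  Automorphisms are functions on the ball only, hence extensional.\<close>

definition Aut_ball :: "(complex ^ 'm) set \<Rightarrow> (complex ^ 'm \<Rightarrow> complex ^ 'm) set"
  where "Aut_ball W = {\<phi> \<in> extensional (unit_ball W).
    bij_betw \<phi> (unit_ball W) (unit_ball W) \<and>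
    holomorphic_map_on \<phi> (unit_ball W) \<and>
    holomorphic_map_on (inv_into (unit_ball W) \<phi>) (unit_ball W)}"

definition unitary_group :: "(complex ^ 'm \<Rightarrow> complex ^ 'm) set"
  where "unitary_group = {restrict ((*v) U) (unit_ball UNIV) |U. unitary_matrix U}"

text \<open>The group of a map from the unit ball of \<^typ>\<open>complex ^ 'n\<close> into the unit ball of the complex
  subspace \<open>W\<close>.\<close>

definition hermitian_group ::
    "(complex ^ 'k) set \<Rightarrow> (complex ^ 'n \<Rightarrow> complex ^ 'k) \<Rightarrow> (complex ^ 'n \<Rightarrow> complex ^ 'n) set"
  where "hermitian_group W f = {\<gamma> \<in> Aut_ball UNIV.
    \<exists>\<psi>\<in>Aut_ball W. \<forall>z\<in>unit_ball UNIV. f (\<gamma> z) = \<psi> (f z)}"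


section \<open>Polynomial maps and the tensor operation\<close>

text \<open>A vector valued polynomial is a finitely supported family of coefficient vectors, indexed by
  multi-indices.\<close>

definition mdeg :: "('n::finite \<Rightarrow> nat) \<Rightarrow> nat"
  where "mdeg \<alpha> = (\<Sum>i\<in>UNIV. \<alpha> i)"

definition poly_map :: "(('n::finite \<Rightarrow> nat) \<Rightarrow>\<^sub>0 complex ^ 'N) \<Rightarrow> complex ^ 'n \<Rightarrow> complex ^ 'N"
  where "poly_map P z = (\<Sum>\<alpha>\<in>Poly_Mapping.keys P. (\<Prod>i\<in>UNIV. z $ i ^ \<alpha> i) *s Poly_Mapping.lookup P \<alpha>)"

text \<open>Junk for \<open>P = 0\<close>, whose polynomial map is not proper between balls.\<close>

definition lowest_order :: "(('n::finite \<Rightarrow> nat) \<Rightarrow>\<^sub>0 complex ^ 'N) \<Rightarrow> nat"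
  where "lowest_order P = Min (mdeg ` Poly_Mapping.keys P)"

definition lowest_order_space :: "(('n::finite \<Rightarrow> nat) \<Rightarrow>\<^sub>0 complex ^ 'N) \<Rightarrow> (complex ^ 'N) set"
  where "lowest_order_space P = vec.span (Poly_Mapping.lookup P ` {\<alpha>. mdeg \<alpha> = lowest_order P})"

definition tensor :: "complex ^ 'N \<Rightarrow> complex ^ 'n \<Rightarrow> complex ^ ('N \<times> 'n)"
  where "tensor a z = (\<chi> p. a $ fst p * z $ snd p)"

definition direct_sum :: "complex ^ 'k \<Rightarrow> complex ^ 'm \<Rightarrow> complex ^ ('k + 'm)"
  where "direct_sum x y = (\<chi> s. case s of Inl i \<Rightarrow> x $ i | Inr j \<Rightarrow> y $ j)"

text \<open>The orthogonal sum of \<open>A \<otimes> \<complex>\<^sup>n\<close> and the orthogonal complement of \<open>A\<close>, as a complex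
  subspace of \<^typ>\<open>complex ^ ('N \<times> 'n + 'N)\<close> with the induced Hermitian structure. The codomain
  ball of \<open>Ef\<close> is the unit ball of this subspace, not of the ambient space.\<close>

definition tensor_target :: "(complex ^ 'N) set \<Rightarrow> (complex ^ ('N \<times> 'n::finite + 'N)) set"
  where "tensor_target A =
    {direct_sum x y |x y. x \<in> vec.span {tensor a v |a v. a \<in> A} \<and> y \<in> orth_compl A}"

definition tensor_op :: "(complex ^ 'N) set \<Rightarrow> (complex ^ 'n \<Rightarrow> complex ^ 'N) \<Rightarrow>
    complex ^ 'n \<Rightarrow> complex ^ ('N \<times> 'n + 'N)"
  where "tensor_op A f z = direct_sum (tensor (orth_proj A (f z)) z) (f z - orth_proj A (f z))"


section \<open>Consistency of the definitions\<close>

text \<open>\<^const>\<open>proper_map\<close> agrees with the definition by compact preimages.\<close>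

lemma proper_map_unit_ball_iff:
  fixes f :: "complex ^ 'n \<Rightarrow> complex ^ 'N"
  assumes "continuous_on (unit_ball UNIV) f" "f ` unit_ball UNIV \<subseteq> unit_ball UNIV"
  shows "proper_map (top_of_set (unit_ball UNIV)) (top_of_set (unit_ball UNIV)) f \<longleftrightarrow>
    (\<forall>K. compact K \<and> K \<subseteq> unit_ball UNIV \<longrightarrow> compact {z \<in> unit_ball UNIV. f z \<in> K})"
proof -
  let ?X = "top_of_set (unit_ball UNIV) :: (complex ^ 'n) topology"
  let ?Y = "top_of_set (unit_ball UNIV) :: (complex ^ 'N) topology"
  have lc: "locally_compact_space ?Y"
    by (simp add: unit_ball_def locally_compact_space_open_subset locally_compact_space_euclidean)
  have H: "Hausdorff_space ?Y"
    by (simp add: Hausdorff_space_subtopology)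
  have k: "k_space ?Y" "kc_space ?Y"
    using lc H by (auto simp: locally_compact_imp_k_space Hausdorff_imp_kc_space)
  have c: "continuous_map ?X ?Y f"
    using assms by (auto simp: continuous_map_in_subtopology)
  show ?thesis
    unfolding proper_eq_compact_map[OF k disjI1[OF c]]
    using assms(2) by (simp add: compactin_subtopology image_subset_iff_funcset Collect_mono_iff
        subset_iff)
qed

lemma inner_eq_Re_herm: "x \<bullet> y = Re (herm x y)"
  by (simp add: herm_def inner_vec_def inner_complex_def)

lemma herm_self: "herm x x = of_real ((norm x)\<^sup>2)"
proof -
  have "herm x x = (\<Sum>i\<in>UNIV. of_real ((cmod (x $ i))\<^sup>2))"
    by (simp only: herm_def complex_norm_square)
  also have "\<dots> = of_real (\<Sum>i\<in>UNIV. (cmod (x $ i))\<^sup>2)"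
    by simp
  also have "\<dots> = of_real ((norm x)\<^sup>2)"
    by (simp add: norm_vec_def L2_set_def sum_nonneg)
  finally show ?thesis .
qed

lemma herm_scale_right: "herm x (c *s y) = cnj c * herm x y"
  by (simp add: herm_def sum_distrib_left algebra_simps)

lemma herm_diff_left: "herm (x - y) z = herm x z - herm y z"
  by (simp add: herm_def sum_subtractf algebra_simps)

lemma herm_unitary:
  assumes "unitary_matrix U"
  shows "herm (U *v x) (U *v y) = herm x y"
proof -
  have "herm (U *v x) w = herm x (conj_transpose U *v w)" for w
  proof -
    have "herm (U *v x) w = (\<Sum>i\<in>UNIV. \<Sum>j\<in>UNIV. U $ i $ j * x $ j * cnj (w $ i))"
      by (simp add: herm_def matrix_vector_mult_def sum_distrib_right)
    also have "\<dots> = (\<Sum>j\<in>UNIV. \<Sum>i\<in>UNIV. U $ i $ j * x $ j * cnj (w $ i))"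
      by (rule sum.swap)
    also have "\<dots> = herm x (conj_transpose U *v w)"
      by (simp add: herm_def matrix_vector_mult_def conj_transpose_def sum_distrib_left algebra_simps)
    finally show ?thesis .
  qed
  then show ?thesis
    using assms by (simp add: matrix_vector_mul_assoc unitary_matrix_def)
qed

lemma norm_unitary:
  assumes "unitary_matrix U" shows "norm (U *v x) = norm x"
proof -
  have "complex_of_real ((norm (U *v x))\<^sup>2) = of_real ((norm x)\<^sup>2)"
    using herm_unitary[OF assms, of x x] by (simp only: herm_self)
  then have "(norm (U *v x))\<^sup>2 = (norm x)\<^sup>2"
    by (simp only: of_real_eq_iff)
  then show ?thesis by simp
qed

lemma unitary_group_subset_Aut: "unitary_group \<subseteq> Aut_ball UNIV"
proof (rule subsetI)
  fix g :: "complex ^ 'm \<Rightarrow> complex ^ 'm"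
  let ?B = "unit_ball UNIV :: (complex ^ 'm) set"
  assume "g \<in> unitary_group"
  then obtain U where U: "unitary_matrix U" and g: "g = restrict ((*v) U) ?B"
    by (auto simp: unitary_group_def)
  let ?V = "conj_transpose U"
  have "conj_transpose ?V = U"
    by (simp add: conj_transpose_def vec_eq_iff)
  with U have V: "unitary_matrix ?V"
    by (simp add: unitary_matrix_def)
  have ball: "W *v x \<in> ?B" if "x \<in> ?B" "unitary_matrix W" for W x
    using that by (simp add: unit_ball_def norm_unitary)
  have UV: "U *v (?V *v x) = x" and VU: "?V *v (U *v x) = x" for x
    using U by (simp_all add: matrix_vector_mul_assoc unitary_matrix_def)
  have bij: "bij_betw g ?B ?B"
    by (rule bij_betwI[where g = "(*v) ?V"]) (auto simp: g ball U V UV VU)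
  have inv: "inv_into ?B g y = ?V *v y" if "y \<in> ?B" for y
    using bij that by (intro inv_into_f_eq) (auto simp: bij_betw_def g ball V UV)
  have hol: "holomorphic_map_on h ?B" if h: "\<And>x. x \<in> ?B \<Longrightarrow> h x = W *v x"
    for W :: "complex ^ 'm ^ 'm" and h
    unfolding holomorphic_map_on_def
  proof (intro ballI exI conjI allI)
    fix x assume x: "x \<in> ?B"
    have "linear ((*v) W)"
      by (auto intro!: linearI simp: matrix_vector_right_distrib vec_eq_iff
          matrix_vector_mult_def scaleR_right.sum)
    then have "((*v) W has_derivative (*v) W) (at x within ?B)"
      by (simp add: linear_linear linear_imp_has_derivative)
    then show "(h has_derivative (*v) W) (at x within ?B)"
      using x h by (auto intro: has_derivative_transform)
    show "W *v (c *s v) = c *s (W *v v)" for c v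
      by (simp add: vec.scale)
  qed
  have "g \<in> extensional ?B"
    by (simp add: g)
  moreover have "holomorphic_map_on g ?B"
    by (rule hol[of _ U]) (simp add: g)
  moreover have "holomorphic_map_on (inv_into ?B g) ?B"
    by (rule hol[of _ ?V]) (simp add: inv)
  ultimately show "g \<in> Aut_ball UNIV"
    using bij by (simp add: Aut_ball_def)
qed

lemma orth_proj_unique:
  assumes "vec.subspace A"
  shows "\<exists>!y. y \<in> A \<and> x - y \<in> orth_compl A"
proof -
  have "subspace A"
  proof (rule subspaceI)
    show "0 \<in> A" by (rule vec.subspace_0[OF assms])
    show "u + v \<in> A" if "u \<in> A" "v \<in> A" for u v
      using that by (rule vec.subspace_add[OF assms])
    show "c *\<^sub>R v \<in> A" if "v \<in> A" for c v
    proof -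
      have "c *\<^sub>R v = complex_of_real c *s v"
        by (simp add: vec_eq_iff scaleR_conv_of_real[where 'a = complex])
      then show ?thesis using vec.subspace_scale[OF assms that] by simp
    qed
  qed
  then have span: "span A = A" by simp
  obtain y z where y: "y \<in> A" and z: "\<And>w. w \<in> A \<Longrightarrow> orthogonal z w" and xyz: "x = y + z"
    using orthogonal_subspace_decomp_exists[of A x] unfolding span by metis
  have "herm z a = 0" if a: "a \<in> A" for a
  proof -
    have "z \<bullet> a = 0" "z \<bullet> (\<i> *s a) = 0"
      using z a vec.subspace_scale[OF assms a] by (auto simp: orthogonal_def)
    then show ?thesis
      by (simp add: inner_eq_Re_herm herm_scale_right complex_eq_iff)
  qed
  then have ex: "y \<in> A \<and> x - y \<in> orth_compl A"
    using y xyz by (simp add: orth_compl_def)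
  moreover have "y' = y" if "y' \<in> A \<and> x - y' \<in> orth_compl A" for y'
  proof -
    have d: "y' - y \<in> A" using that y by (auto intro: vec.subspace_diff[OF assms])
    have "herm (y' - y) (y' - y) = herm (x - y) (y' - y) - herm (x - y') (y' - y)"
      by (simp flip: herm_diff_left)
    also have "\<dots> = 0" using that ex d by (simp add: orth_compl_def)
    finally show ?thesis by (simp add: herm_self)
  qed
  ultimately show ?thesis by blast
qed

lemma tensor_op_in_target:
  assumes "vec.subspace A" shows "tensor_op A f z \<in> tensor_target A"
proof -
  have "orth_proj A (f z) \<in> A \<and> f z - orth_proj A (f z) \<in> orth_compl A"
    unfolding orth_proj_def by (rule theI'[OF orth_proj_unique[OF assms]])
  then show ?thesis
    unfolding tensor_op_def tensor_target_def by (blast intro: vec.span_base)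
qed

lemma herm_direct_sum: "herm (direct_sum x y) (direct_sum x' y') = herm x x' + herm y y'"
proof -
  have "herm (direct_sum x y) (direct_sum x' y') =
      (\<Sum>s\<in>UNIV <+> UNIV. direct_sum x y $ s * cnj (direct_sum x' y' $ s))"
    by (simp add: herm_def)
  also have "\<dots> = herm x x' + herm y y'"
    by (subst sum.Plus) (simp_all add: herm_def direct_sum_def)
  finally show ?thesis .
qed

lemma herm_tensor: "herm (tensor a z) (tensor b w) = herm a b * herm z w"
proof -
  have "herm (tensor a z) (tensor b w) =
      (\<Sum>p\<in>UNIV \<times> UNIV. tensor a z $ p * cnj (tensor b w $ p))"
    by (simp add: herm_def)
  also have "\<dots> = herm a b * herm z w"
    by (simp only: sum.cartesian_product[symmetric] sum.cartesian_product')
      (simp add: herm_def tensor_def sum_product algebra_simps)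
  finally show ?thesis .
qed

end

theory Submission
  imports Defs "HOL-Complex_Analysis.Conformal_Mappings"
begin

text \<open>Let \<open>\<gamma>\<close> be the restriction of a unitary map \<open>T\<close> with \<open>f \<circ> \<gamma> = \<psi> \<circ> f\<close>. Everything follows once
  \<open>f\<close> and \<open>f \<circ> T\<close> are known to have the same Gram kernel,
  \<open>\<langle>f(Tz), f(Tw)\<rangle> = \<langle>f(z), f(w)\<rangle>\<close> for all \<open>z\<close> and \<open>w\<close> (\<open>poly_map_Gram_invariant\<close>); the automorphism
  \<open>\<psi>\<close> itself need not be unitary, because only its values on the image of \<open>f\<close> are constrained.

  To obtain the kernel identity, put \<open>b = \<psi>\<^sup>-\<^sup>1(0)\<close>. The Schwarz lemma compares \<open>\<psi>\<close> with the
  Moebius involution exchanging \<open>0\<close> and \<open>b\<close> and yields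
  \<open>(1 - |\<psi>(w)|\<^sup>2) |1 - \<langle>w, b\<rangle>|\<^sup>2 = (1 - |b|\<^sup>2) (1 - |w|\<^sup>2)\<close> (\<open>Aut_ball_norm_identity\<close>). Inserting
  \<open>w = f(z)\<close> and polarizing gives, with \<open>g = 1 - \<langle>f, b\<rangle>\<close> and \<open>c = 1 - |b|\<^sup>2\<close>,
  \<open>(1 - \<langle>f(Tz), f(Tw)\<rangle>) g(z) cnj(g(w)) = c (1 - \<langle>f(z), f(w)\<rangle>)\<close> on the whole space. For \<open>w = 0\<close> this
  says that the polynomial \<open>H = 1 - \<langle>f, f(0)\<rangle>\<close> is, up to a constant factor, \<open>g \<cdot> (H \<circ> T)\<close>. Since \<open>H\<close>
  and \<open>H \<circ> T\<close> have the same degree, \<open>g\<close> is constant (\<open>entire_cofactor_constant\<close>). This is where it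
  matters that \<open>f\<close> is a polynomial. Comparing both sides at the origin then removes the constants.

  Two families in a complex subspace with equal Gram kernels are related by a linear isometry of that
  subspace (\<open>isometry_of_equal_Gram\<close>). Hence there is a unitary \<open>V\<close> with \<open>V \<circ> f = f \<circ> T\<close>. It
  intertwines the homogeneous parts of \<open>f\<close> in each degree; as \<open>A\<close> is spanned by the values of the
  lowest one, \<open>V\<close> maps \<open>A\<close> onto itself and commutes with the projection onto \<open>A\<close>. Therefore the Gram
  kernel of \<open>Ef\<close> is invariant under \<open>T\<close> as well, and the same lemma, now applied in the target
  subspace of \<open>Ef\<close>, supplies the isometry that carries \<open>Ef\<close> to \<open>Ef \<circ> T\<close>.\<close>

section \<open>Hermitian isometries of a subspace\<close>

lemma herm_cnj: "cnj (herm x y) = herm y x"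
  by (simp add: herm_def mult.commute)

lemma herm_add_left: "herm (x + y) z = herm x z + herm y z"
  by (simp add: herm_def sum.distrib algebra_simps)

lemma herm_add_right: "herm x (y + z) = herm x y + herm x z"
  by (simp add: herm_def sum.distrib algebra_simps)

lemma herm_diff_right: "herm x (y - z) = herm x y - herm x z"
  by (simp add: herm_def sum_subtractf algebra_simps)

lemma herm_scale_left: "herm (c *s x) y = c * herm x y"
  by (simp add: herm_def sum_distrib_left algebra_simps)

lemma herm_zero_left [simp]: "herm 0 y = 0"
  by (simp add: herm_def)

lemma herm_zero_right [simp]: "herm x 0 = 0"
  by (simp add: herm_def)

lemma herm_self_eq_0_iff: "herm x x = 0 \<longleftrightarrow> x = 0"
  by (simp add: herm_self)

lemmas herm_simps = herm_add_left herm_add_right herm_diff_left herm_diff_right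
  herm_scale_left herm_scale_right

lemma scaleR_eq_of_real_scale: "r *\<^sub>R v = complex_of_real r *s v"
  by (simp add: vec_eq_iff scaleR_conv_of_real[where 'a = complex])

text \<open>The map is linear on the ambient space, not just on \<open>W\<close>, so that it is its own derivative at every
  point and has a linear inverse there; the last conjunct makes it a symmetry of the unit ball of \<open>W\<close>.\<close>

definition hermitian_isometry :: "(complex ^ 'm) set \<Rightarrow> (complex ^ 'm \<Rightarrow> complex ^ 'm) \<Rightarrow> bool"
  where "hermitian_isometry W T \<longleftrightarrow> Vector_Spaces.linear (*s) (*s) T \<and>
    (\<forall>x y. herm (T x) (T y) = herm x y) \<and> T ` W = W"

lemma hermitian_isometryD:
  assumes "hermitian_isometry W T"
  shows "T (x + y) = T x + T y" "T (c *s x) = c *s T x" "T (x - y) = T x - T y" "T 0 = 0"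
    "herm (T x) (T y) = herm x y" "T ` W = W" "norm (T x) = norm x" "inj T"
proof -
  have L: "Vector_Spaces.linear (*s) (*s) T"
    and H: "\<And>x y. herm (T x) (T y) = herm x y" and "T ` W = W"
    using assms by (auto simp: hermitian_isometry_def)
  show "T (x + y) = T x + T y" by (rule vec.linear_add[OF L])
  show "T (c *s x) = c *s T x" by (rule vec.linear_scale[OF L])
  show d: "T (x - y) = T x - T y" for x y by (rule vec.linear_diff[OF L])
  show z: "T 0 = 0" by (rule vec.linear_0[OF L])
  show "herm (T x) (T y) = herm x y" "T ` W = W" by fact+
  show n: "norm (T x) = norm x" for x
    using H[of x x] by (simp add: herm_self flip: of_real_power)
  show "inj T"
    by (rule injI) (metis d n norm_eq_zero right_minus_eq)
qed

lemma hermitian_isometry_compose: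
  assumes "hermitian_isometry W S" "hermitian_isometry W T"
  shows "hermitian_isometry W (S \<circ> T)"
  using assms Vector_Spaces.linear_compose[of "(*s)" "(*s)" T "(*s)" S]
  unfolding hermitian_isometry_def by (auto simp only: o_apply image_comp[symmetric])

text \<open>Of two vectors of equal length, the first is moved to the second by the complex reflection
  along \<open>u = x - y\<close>, namely \<open>v \<mapsto> v - (\<langle>v, u\<rangle> / \<langle>x, u\<rangle>) u\<close>. It multiplies \<open>u\<close> by the unimodular number \<open>- cnj p / p\<close> with
  \<open>p = \<langle>x, u\<rangle>\<close>, because \<open>|u|\<^sup>2 = p + cnj p\<close>, and fixes the orthogonal complement of \<open>u\<close>. Hence it can
  correct one vector of a family without moving those that are already in place.\<close>

lemma complex_reflection_exists:
  assumes W: "vec.subspace W" "x \<in> W" "y \<in> W" and norm: "herm x x = herm y y"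
  obtains R where "hermitian_isometry W R" "R x = y"
    "\<And>v. herm v x = herm v y \<Longrightarrow> R v = v"
proof (cases "x = y")
  case True
  have "hermitian_isometry W id"
    by (simp add: hermitian_isometry_def vec.linear_id)
  then show ?thesis using that[of id] True by simp
next
  case False
  define u where "u = x - y"
  define p where "p = herm x u"
  define R where "R a v = v - (herm v u / a) *s u" for a v
  have u: "u \<noteq> 0" "u \<in> W"
    using False vec.subspace_diff[OF W] by (auto simp: u_def)
  have y: "herm y u = - cnj p"
    using norm by (simp add: p_def u_def herm_simps herm_cnj)
  have uu: "herm u u = p + cnj p"
    unfolding u_def[symmetric] using y by (metis herm_diff_left p_def u_def diff_minus_eq_add)
  have p: "p \<noteq> 0"
    using uu u by (auto simp: herm_self_eq_0_iff)
  have lin: "Vector_Spaces.linear (*s) (*s) (R a)" for a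
    by (auto intro: vec.vector_space_axioms
        simp: Vector_Spaces.linear_iff R_def herm_simps vec_eq_iff algebra_simps add_divide_distrib)
  have inW: "R a v \<in> W" if "v \<in> W" for a v
    using that u by (simp add: R_def vec.subspace_diff[OF W(1)] vec.subspace_scale[OF W(1)])
  \<comment> \<open>The inverse reflection exchanges the roles of \<open>x\<close> and \<open>y\<close>: its parameter is
    \<open>\<langle>y, - u\<rangle> = cnj p\<close>, and replacing \<open>u\<close> by \<open>- u\<close> does not change the formula.\<close>
  have inv: "R p (R (cnj p) v) = v" for v
  proof -
    have "R p (R (cnj p) v) =
        v - (herm v u / cnj p + (herm v u - herm v u / cnj p * (p + cnj p)) / p) *s u"
      by (simp add: R_def herm_diff_left herm_scale_left uu vec.scale_left_distrib)
    also have "herm v u / cnj p + (herm v u - herm v u / cnj p * (p + cnj p)) / p = 0"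
      using p by (simp add: divide_simps) (simp add: algebra_simps)
    finally show ?thesis by simp
  qed
  have iso: "herm (R p v) (R p w) = herm v w" for v w
  proof -
    have "herm (R p v) (R p w) = herm v w - herm v u / p * herm u w
        - herm u w / cnj p * (herm v u - herm v u / p * (p + cnj p))"
      by (simp add: R_def herm_diff_left herm_scale_left herm_diff_right herm_scale_right uu herm_cnj)
    also have "\<dots> = herm v w"
      using p by (simp add: divide_simps) (simp add: algebra_simps)
    finally show ?thesis .
  qed
  have "R p ` W = W"
    using inW inv by (metis (no_types, lifting) image_eqI image_subsetI subsetI subset_antisym)
  then have "hermitian_isometry W (R p)"
    using lin iso by (simp add: hermitian_isometry_def)
  moreover have "R p x = y"
    using p by (simp add: R_def u_def flip: p_def[unfolded u_def])
  moreover have "R p v = v" if "herm v x = herm v y" for v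
    using that by (simp add: R_def u_def herm_simps)
  ultimately show ?thesis by (rule that)
qed

text \<open>Vectors are put in place one at a time. The image of the next vector under the isometry found so
  far has the same inner products with the earlier targets as its own target, so the reflection that
  moves it there fixes the earlier targets.\<close>

lemma isometry_extending_finite:
  assumes W: "vec.subspace W" and "finite I"
    and "\<And>i. i \<in> I \<Longrightarrow> X i \<in> W" "\<And>i. i \<in> I \<Longrightarrow> Y i \<in> W"
    and "\<And>i j. i \<in> I \<Longrightarrow> j \<in> I \<Longrightarrow> herm (X i) (X j) = herm (Y i) (Y j)"
  obtains T where "hermitian_isometry W T" "\<And>i. i \<in> I \<Longrightarrow> T (X i) = Y i"
  using assms(2-)
proof (induction I arbitrary: thesis)
  case empty
  have "hermitian_isometry W id"
    by (simp add: hermitian_isometry_def vec.linear_id)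
  then show ?case using empty(1)[of id] by blast
next
  case (insert k I)
  obtain T where T: "hermitian_isometry W T" "\<And>i. i \<in> I \<Longrightarrow> T (X i) = Y i"
    using insert.IH insert.prems by (metis insertCI)
  note D = hermitian_isometryD[OF T(1)]
  have "T (X k) \<in> W"
    using D(6) insert.prems(2) by auto
  moreover have "herm (T (X k)) (T (X k)) = herm (Y k) (Y k)"
    using insert.prems(4) by (simp add: D)
  ultimately obtain R where R: "hermitian_isometry W R" "R (T (X k)) = Y k"
    "\<And>v. herm v (T (X k)) = herm v (Y k) \<Longrightarrow> R v = v"
    using complex_reflection_exists[OF W] insert.prems(3) by (metis insertCI)
  have "R (T (X i)) = Y i" if "i \<in> I" for i
  proof -
    have "herm (Y i) (T (X k)) = herm (Y i) (Y k)"
      using that insert.prems(4) D(5) T(2) by (metis insertCI)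
    then show ?thesis using R(3) T(2) that by simp
  qed
  moreover have "hermitian_isometry W (R \<circ> T)"
    using R(1) T(1) by (rule hermitian_isometry_compose)
  ultimately show ?case
    using insert.prems(1)[of "R \<circ> T"] R(2) by fastforce
qed

text \<open>The finite case is applied to a maximal independent subfamily of \<open>X\<close>. The remaining vectors then
  follow automatically: equality of the Gram kernels gives \<open>\<langle>T x, Y i\<rangle> = \<langle>x, X i\<rangle>\<close> for \<open>x\<close> in the
  subfamily, hence in its span, and at \<open>x = X i\<close> this forces \<open>|T (X i) - Y i| = 0\<close>.\<close>

lemma isometry_of_equal_Gram:
  fixes X Y :: "'i \<Rightarrow> complex ^ 'm"
  assumes W: "vec.subspace W" and X: "\<And>i. X i \<in> W" and Y: "\<And>i. Y i \<in> W"
    and gram: "\<And>i j. herm (X i) (X j) = herm (Y i) (Y j)"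
  obtains T where "hermitian_isometry W T" "\<And>i. T (X i) = Y i"
proof -
  obtain B where B: "B \<subseteq> range X" "vec.independent B" "range X \<subseteq> vec.span B"
    by (rule vec.maximal_independent_subset)
  obtain I where I: "B = X ` I" "finite I"
    using finite_subset_image[OF vec.finiteI_independent[OF B(2)] B(1)] by auto
  obtain T where T: "hermitian_isometry W T" "\<And>i. i \<in> I \<Longrightarrow> T (X i) = Y i"
    using isometry_extending_finite[OF W I(2), of X Y] X Y gram by metis
  note D = hermitian_isometryD[OF T(1)]
  have "T (X i) = Y i" for i
  proof -
    have "x \<in> vec.span B \<Longrightarrow> herm (T x) (Y i) = herm x (X i)" for x
    proof (induction rule: vec.span_induct_alt)
      case base
      then show ?case by (simp add: D)
    next
      case (step c x y)
      then show ?case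
        using T(2) gram by (auto simp: I D herm_simps)
    qed
    then have e: "herm (T (X i)) (Y i) = herm (X i) (X i)"
      using B(3) by auto
    then have "herm (Y i) (T (X i)) = herm (X i) (X i)"
      by (metis herm_cnj)
    with e have "herm (T (X i) - Y i) (T (X i) - Y i) = 0"
      by (simp add: herm_simps D gram)
    then show ?thesis by (simp add: herm_self_eq_0_iff)
  qed
  with T(1) show ?thesis by (rule that)
qed

lemma complex_linear_holomorphic:
  assumes T: "Vector_Spaces.linear (*s) (*s) T" and h: "\<And>x. x \<in> S \<Longrightarrow> h x = T x"
  shows "holomorphic_map_on h S"
  unfolding holomorphic_map_on_def
proof (intro ballI exI conjI allI)
  fix x assume x: "x \<in> S"
  have "T (r *\<^sub>R v) = r *\<^sub>R T v" for r v
    using vec.linear_scale[OF T, of "of_real r" v] by (simp add: scaleR_eq_of_real_scale)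
  then have "linear T"
    by (intro linearI vec.linear_add[OF T])
  then have "(T has_derivative T) (at x within S)"
    by (simp add: linear_linear linear_imp_has_derivative)
  then show "(h has_derivative T) (at x within S)"
    using x h by (auto intro: has_derivative_transform)
  show "T (c *s v) = c *s T v" for c v
    by (rule vec.linear_scale[OF T])
qed

lemma hermitian_isometry_in_Aut_ball:
  assumes "hermitian_isometry W T"
  shows "restrict T (unit_ball W) \<in> Aut_ball W"
proof -
  note D = hermitian_isometryD[OF assms]
  have L: "Vector_Spaces.linear (*s) (*s) T"
    using assms by (simp add: hermitian_isometry_def)
  obtain S where S: "Vector_Spaces.linear (*s) (*s) S" "S \<circ> T = id"
    using vec.linear_injective_left_inverse[OF L D(8)] by blast
  have ST: "S (T x) = x" for x using S(2) by (metis comp_apply id_apply)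
  have im: "T ` unit_ball W = unit_ball W"
    using D(6,7) by (fastforce simp: unit_ball_def)
  have bij: "bij_betw (restrict T (unit_ball W)) (unit_ball W) (unit_ball W)"
    using im inj_on_subset[OF D(8)] by (simp add: bij_betw_def inj_on_restrict_eq)
  have inv: "inv_into (unit_ball W) (restrict T (unit_ball W)) y = S y" if "y \<in> unit_ball W" for y
  proof -
    have "y \<in> T ` unit_ball W" using im that by simp
    then obtain x where "x \<in> unit_ball W" "y = T x" by blast
    then show ?thesis
      using bij by (intro inv_into_f_eq) (simp_all add: bij_betw_def ST)
  qed
  show ?thesis
    using bij complex_linear_holomorphic[OF L] complex_linear_holomorphic[OF S(1)] inv
    by (simp add: Aut_ball_def)
qed

section \<open>Automorphisms of the ball\<close>

lemma norm_complex_scale: "norm (c *s x) = cmod c * norm (x :: complex ^ 'm)"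
proof -
  have "complex_of_real ((norm (c *s x))\<^sup>2) = c * cnj c * herm x x"
    by (simp only: herm_self[symmetric] herm_scale_left herm_scale_right ac_simps)
  also have "\<dots> = complex_of_real ((cmod c * norm x)\<^sup>2)"
    by (simp add: herm_self power_mult_distrib complex_norm_square[symmetric])
  finally show ?thesis
    by (simp only: of_real_eq_iff) simp
qed

lemma herm_Cauchy_Schwarz: "cmod (herm x y) \<le> norm x * norm y"
proof (cases "herm x y = 0")
  case False
  \<comment> \<open>A unimodular factor makes the Hermitian product real, where it is the inner product.\<close>
  define c where "c = cnj (herm x y) / of_real (cmod (herm x y))"
  have c: "cmod c = 1" using False by (simp add: c_def norm_divide)
  have "herm (c *s x) y = (herm x y * cnj (herm x y)) / of_real (cmod (herm x y))"
    by (simp add: herm_scale_left c_def)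
  also have "\<dots> = of_real (cmod (herm x y))"
    using False by (simp add: complex_norm_square[symmetric] power2_eq_square)
  finally have "herm (c *s x) y = of_real (cmod (herm x y))" .
  then have "cmod (herm x y) = (c *s x) \<bullet> y"
    by (simp add: inner_eq_Re_herm)
  also have "\<dots> \<le> norm (c *s x) * norm y" by (rule norm_cauchy_schwarz)
  finally show ?thesis by (simp add: norm_complex_scale c)
qed simp

lemma bounded_linear_herm_left: "bounded_linear (\<lambda>x. herm x y)"
  unfolding linear_conv_bounded_linear[symmetric]
  by (rule linearI) (simp_all add: herm_add_left scaleR_eq_of_real_scale herm_scale_left
      scaleR_conv_of_real)

lemma herm_sum_left: "herm (\<Sum>k\<in>K. F k) y = (\<Sum>k\<in>K. herm (F k) y)"
  by (rule linear_sum[OF bounded_linear.linear[OF bounded_linear_herm_left]])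

lemma bounded_bilinear_complex_scale:
  "bounded_bilinear ((*s) :: complex \<Rightarrow> complex ^ 'm \<Rightarrow> complex ^ 'm)"
  unfolding bilinear_conv_bounded_bilinear[symmetric] bilinear_def
  by (auto intro!: linearI simp: vec_eq_iff algebra_simps)

lemmas has_derivative_herm_left [derivative_intros] =
  bounded_linear.has_derivative[OF bounded_linear_herm_left]

lemmas has_derivative_complex_scale =
  bounded_bilinear.FDERIV[OF bounded_bilinear_complex_scale]

lemma holomorphic_map_on_compose:
  assumes "holomorphic_map_on f S" "holomorphic_map_on g T" "f ` S \<subseteq> T"
  shows "holomorphic_map_on (\<lambda>x. g (f x)) S"
  unfolding holomorphic_map_on_def
proof
  fix x assume x: "x \<in> S"
  obtain D where D: "(f has_derivative D) (at x within S)" "\<And>c v. D (c *s v) = c *s D v"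
    using assms(1) x unfolding holomorphic_map_on_def by blast
  obtain E where E: "(g has_derivative E) (at (f x) within T)" "\<And>c v. E (c *s v) = c *s E v"
    using assms(2,3) x unfolding holomorphic_map_on_def by blast
  have "((\<lambda>x. g (f x)) has_derivative (\<lambda>v. E (D v))) (at x within S)"
    using D(1) has_derivative_subset[OF E(1) assms(3)] by (rule has_derivative_in_compose)
  then show "\<exists>D. ((\<lambda>x. g (f x)) has_derivative D) (at x within S) \<and> (\<forall>c v. D (c *s v) = c *s D v)"
    using D(2) E(2) by (intro exI[of _ "\<lambda>v. E (D v)"]) simp
qed

text \<open>The one-variable Schwarz lemma, applied to the component of \<open>F\<close> in the direction of \<open>F z\<close> along the
  complex disc through \<open>0\<close> and \<open>z\<close>.\<close>

lemma ball_Schwarz: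
  fixes F :: "complex ^ 'm \<Rightarrow> complex ^ 'k"
  assumes hol: "holomorphic_map_on F (ball 0 1)" and ball: "F ` ball 0 1 \<subseteq> ball 0 1"
    and 0: "F 0 = 0" and z: "norm z < 1"
  shows "norm (F z) \<le> norm z"
proof (cases "z = 0 \<or> F z = 0")
  case False
  define e where "e = complex_of_real (1 / norm z) *s z"
  define u where "u = complex_of_real (1 / norm (F z)) *s F z"
  have e: "norm e = 1" and u: "norm u = 1"
    using False by (simp_all add: e_def u_def norm_complex_scale norm_divide)
  define \<phi> where "\<phi> l = herm (F (l *s e)) u" for l
  have in_ball: "l *s e \<in> ball 0 1" if "norm l < 1" for l
    using that by (simp add: norm_complex_scale e)
  have "cmod (\<phi> (of_real (norm z))) \<le> cmod (of_real (norm z))"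
  proof (rule Schwarz_Lemma(1))
    show "\<phi> holomorphic_on ball 0 1"
      unfolding holomorphic_on_def field_differentiable_def
    proof
      fix l :: complex assume l: "l \<in> ball 0 1"
      then have le: "l *s e \<in> ball 0 1" by (intro in_ball) simp
      obtain D where D: "(F has_derivative D) (at (l *s e) within ball 0 1)"
        "\<And>c v. D (c *s v) = c *s D v"
        using hol le unfolding holomorphic_map_on_def by blast
      have D': "(F has_derivative D) (at (l *s e))"
        using D(1) at_within_open[OF le open_ball] by simp
      have "((\<lambda>l. l *s e) has_derivative (\<lambda>h. h *s e)) (at l)"
        using bounded_linear_imp_has_derivative
          bounded_bilinear.bounded_linear_left[OF bounded_bilinear_complex_scale] by blast
      then have "((\<lambda>l. F (l *s e)) has_derivative (\<lambda>h. D (h *s e))) (at l)"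
        using has_derivative_compose D' by blast
      then have "(\<phi> has_derivative (\<lambda>h. herm (D (h *s e)) u)) (at l)"
        unfolding \<phi>_def by (rule has_derivative_herm_left)
      then have "(\<phi> has_field_derivative herm (D e) u) (at l)"
        by (simp add: has_field_derivative_def D(2) herm_scale_left mult.commute[of "herm (D e) u"]
            flip: lambda_one) (simp add: mult_commute_abs)
      then show "\<exists>f'. (\<phi> has_field_derivative f') (at l within ball 0 1)"
        using has_field_derivative_at_within by blast
    qed
    show "\<phi> 0 = 0" by (simp add: \<phi>_def 0)
    show "cmod (\<phi> l) < 1" if "cmod l < 1" for l
    proof -
      have "cmod (\<phi> l) \<le> norm (F (l *s e)) * norm u"
        unfolding \<phi>_def by (rule herm_Cauchy_Schwarz)
      also have "\<dots> < 1" using ball in_ball[OF that] u by (auto simp: image_subset_iff)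
      finally show ?thesis .
    qed
    show "cmod (complex_of_real (norm z)) < 1" using z by simp
  qed
  moreover have "complex_of_real (norm z) *s e = z"
    using False by (simp add: e_def)
  then have "\<phi> (of_real (norm z)) = of_real (norm (F z))"
    using False by (simp add: \<phi>_def u_def herm_scale_right herm_self power2_eq_square)
  ultimately show ?thesis by simp
qed (use 0 in auto)

text \<open>The standard involutive automorphism of the ball that exchanges \<open>0\<close> and \<open>b\<close>. It is usually
  written with the orthogonal projections onto the line through \<open>b\<close> and its complement; since
  \<open>(1 - s) / |b|\<^sup>2 = 1 / (1 + s)\<close>, the form used here is the same map but makes sense for \<open>b = 0\<close> too.\<close>

definition moebius :: "complex ^ 'm \<Rightarrow> complex ^ 'm \<Rightarrow> complex ^ 'm"
  where "moebius b w = (let s = complex_of_real (sqrt (1 - (norm b)\<^sup>2)); t = herm w b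
    in inverse (1 - t) *s ((1 - t / (1 + s)) *s b - s *s w))"

lemma one_minus_herm_nonzero:
  assumes "norm b < 1" "norm w < 1"
  shows "1 - herm w b \<noteq> 0"
proof -
  have "cmod (herm w b) \<le> norm w * norm b" by (rule herm_Cauchy_Schwarz)
  also have "\<dots> < 1"
    using assms mult_strict_mono'[of "norm w" 1 "norm b" 1] by simp
  finally show ?thesis by auto
qed

text \<open>With \<open>N\<close> the numerator of the Moebius map, the identity to compute is
  \<open>|1 - t|\<^sup>2 - |N|\<^sup>2 = s\<^sup>2 (1 - |w|\<^sup>2)\<close>; it rests on \<open>|b|\<^sup>2 = 1 - s\<^sup>2 = (1 - s) (1 + s)\<close>.\<close>

lemma moebius_norm:
  assumes b: "norm b < 1" and w: "norm w < 1"
  shows "(1 - (norm (moebius b w))\<^sup>2) * (cmod (1 - herm w b))\<^sup>2 = (1 - (norm b)\<^sup>2) * (1 - (norm w)\<^sup>2)"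
proof -
  define s where "s = sqrt (1 - (norm b)\<^sup>2)"
  define S where "S = complex_of_real s"
  define t where "t = herm w b"
  define N where "N = (1 - t / (1 + S)) *s b - S *s w"
  have "(norm b)\<^sup>2 < 1" using b by (simp add: abs_square_less_1)
  then have s: "s > 0" "s\<^sup>2 = 1 - (norm b)\<^sup>2" by (simp_all add: s_def)
  have bb: "herm b b = 1 - S * S"
    using s(2) by (simp add: S_def herm_self power2_eq_square flip: of_real_mult)
  have S: "1 + S \<noteq> 0" "cnj S = S"
    using s(1) by (auto simp: S_def complex_eq_iff)
  have t: "1 - t \<noteq> 0" using one_minus_herm_nonzero[OF b w] by (simp add: t_def)
  have bw: "herm b w = cnj t" by (simp add: t_def herm_cnj)
  have "herm N N = (1 - t / (1 + S)) * (cnj (1 - t / (1 + S)) * (1 - S * S) - S * cnj t)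
     - S * (cnj (1 - t / (1 + S)) * t - S * herm w w)"
    unfolding N_def
    by (simp only: herm_diff_left herm_diff_right herm_scale_left herm_scale_right bw bb S
        t_def[symmetric]) (simp only: algebra_simps)
  also have "\<dots> = (1 - t) * cnj (1 - t) - S * S * (1 - herm w w)"
    using S by (simp add: divide_simps) (simp add: algebra_simps)
  finally have NN: "herm N N = (1 - t) * cnj (1 - t) - S * S * (1 - herm w w)" .
  have "moebius b w = inverse (1 - t) *s N"
    by (simp add: moebius_def N_def s_def S_def t_def Let_def)
  then have "norm (moebius b w) * cmod (1 - t) = norm N"
    using t by (simp add: norm_complex_scale norm_inverse)
  then have "(1 - (norm (moebius b w))\<^sup>2) * (cmod (1 - t))\<^sup>2 = (cmod (1 - t))\<^sup>2 - (norm N)\<^sup>2"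
    by (simp add: algebra_simps flip: power_mult_distrib)
  also have "complex_of_real \<dots> = complex_of_real (s\<^sup>2 * (1 - (norm w)\<^sup>2))"
    using NN by (simp add: herm_self S_def complex_norm_square[symmetric] power2_eq_square[symmetric]
        del: complex_cnj_diff)
  finally show ?thesis
    by (simp only: of_real_eq_iff s(2) t_def)
qed

lemma moebius_in_ball:
  assumes b: "norm b < 1" and w: "norm w < 1"
  shows "norm (moebius b w) < 1"
proof -
  have "(norm b)\<^sup>2 < 1" "(norm w)\<^sup>2 < 1"
    using b w by (simp_all add: abs_square_less_1)
  then have "0 < (1 - (norm (moebius b w))\<^sup>2) * (cmod (1 - herm w b))\<^sup>2"
    unfolding moebius_norm[OF b w] by simp
  then have "(norm (moebius b w))\<^sup>2 < 1"
    by (simp add: zero_less_mult_iff)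
  then show ?thesis by (simp add: abs_square_less_1)
qed

lemma moebius_involution:
  assumes b: "norm b < 1" and w: "norm w < 1"
  shows "moebius b (moebius b w) = w"
proof -
  define S where "S = complex_of_real (sqrt (1 - (norm b)\<^sup>2))"
  define t where "t = herm w b"
  have "(norm b)\<^sup>2 < 1" using b by (simp add: abs_square_less_1)
  then have s: "sqrt (1 - (norm b)\<^sup>2) > 0" "(sqrt (1 - (norm b)\<^sup>2))\<^sup>2 = 1 - (norm b)\<^sup>2" by simp_all
  have bb: "herm b b = 1 - S * S"
    using s(2) unfolding S_def herm_self of_real_mult[symmetric] power2_eq_square by simp
  have S: "1 + S \<noteq> 0" "S \<noteq> 0"
    using s(1) unfolding S_def by (auto simp: complex_eq_iff simp del: real_sqrt_gt_0_iff)
  have t: "1 - t \<noteq> 0" using one_minus_herm_nonzero[OF b w] by (simp add: t_def)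
  have m: "moebius b v = inverse (1 - herm v b) *s ((1 - herm v b / (1 + S)) *s b - S *s v)" for v
    by (simp add: moebius_def S_def Let_def)
  have t': "herm (moebius b w) b = (1 - S * S - t) / (1 - t)"
    unfolding m[of w] herm_scale_left herm_diff_left bb t_def[symmetric] using S t
    by (simp add: divide_simps) (simp add: algebra_simps)
  have i: "inverse (1 - (1 - S * S - t) / (1 - t)) = (1 - t) / (S * S)"
    using S t by (simp add: divide_simps)
  have "moebius b (moebius b w) $ i = w $ i" for i
    unfolding m[of "moebius b w"] t' i unfolding m[of w] t_def[symmetric]
    using S t by (simp add: divide_simps) (simp add: algebra_simps)
  then show ?thesis by (simp add: vec_eq_iff)
qed

lemma moebius_0: "moebius b 0 = b"
  by (simp add: moebius_def)

lemma moebius_self: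
  assumes "norm b < 1" shows "moebius b b = 0"
  using moebius_involution[OF assms, of 0] by (simp add: moebius_0)

lemma moebius_holomorphic:
  fixes b :: "complex ^ 'm"
  assumes b: "norm b < 1"
  shows "holomorphic_map_on (moebius b) (ball 0 1)"
  unfolding holomorphic_map_on_def
proof
  fix w :: "complex ^ 'm" assume "w \<in> ball 0 1"
  then have t: "1 - herm w b \<noteq> 0" using one_minus_herm_nonzero[OF b] by simp
  define S where "S = complex_of_real (sqrt (1 - (norm b)\<^sup>2))"
  define N where "N v = (1 - herm v b / (1 + S)) *s b - S *s v" for v
  define N' where "N' v = - ((herm v b / (1 + S)) *s b) - S *s v" for v
  define C where "C v = herm v b * inverse (1 - herm w b) ^ 2" for v
  have m: "moebius b = (\<lambda>v. inverse (1 - herm v b) *s N v)"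
    by (simp add: moebius_def S_def N_def Let_def fun_eq_iff)
  have "linear N'"
    by (rule linearI) (simp_all add: N'_def vec_eq_iff herm_add_left herm_scale_left
        scaleR_eq_of_real_scale algebra_simps add_divide_distrib)
  then have "((\<lambda>v. b + N' v) has_derivative N') (at w within ball 0 1)"
    by (auto intro!: derivative_eq_intros linear_imp_has_derivative)
  moreover have "(\<lambda>v. b + N' v) = N"
    by (simp add: N_def N'_def fun_eq_iff vec_eq_iff algebra_simps)
  ultimately have "(N has_derivative N') (at w within ball 0 1)" by simp
  moreover have "((\<lambda>v. inverse (1 - herm v b)) has_derivative C) (at w within ball 0 1)"
    unfolding C_def using t
    by (auto intro!: derivative_eq_intros simp: power2_eq_square)
  ultimately have "(moebius b has_derivative
      (\<lambda>v. inverse (1 - herm w b) *s N' v + C v *s N w)) (at w within ball 0 1)"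
    unfolding m by (rule has_derivative_complex_scale[rotated])
  moreover have "inverse (1 - herm w b) *s N' (c *s v) + C (c *s v) *s N w
      = c *s (inverse (1 - herm w b) *s N' v + C v *s N w)" for c v
    by (simp add: vec_eq_iff N'_def C_def herm_scale_left algebra_simps)
  ultimately show "\<exists>D. (moebius b has_derivative D) (at w within ball 0 1) \<and> (\<forall>c v. D (c *s v) = c *s D v)"
    by blast
qed

text \<open>With \<open>b = \<psi>\<^sup>-\<^sup>1(0)\<close>, both \<open>\<psi> \<circ> \<phi>\<close> and \<open>\<phi> \<circ> \<psi>\<^sup>-\<^sup>1\<close> fix the origin, where \<open>\<phi>\<close> is the
  Moebius involution of \<open>b\<close>. The Schwarz inequality for the two maps gives \<open>|\<psi>(w)| = |\<phi>(w)|\<close>, so the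
  identity for \<open>\<phi>\<close> carries over to \<open>\<psi>\<close>.\<close>

lemma Aut_ball_norm_identity:
  fixes \<psi> :: "complex ^ 'm \<Rightarrow> complex ^ 'm"
  assumes "\<psi> \<in> Aut_ball UNIV"
  obtains b where "norm b < 1" "\<And>w. norm w < 1 \<Longrightarrow>
    (1 - (norm (\<psi> w))\<^sup>2) * (cmod (1 - herm w b))\<^sup>2 = (1 - (norm b)\<^sup>2) * (1 - (norm w)\<^sup>2)"
proof -
  let ?B = "ball 0 1 :: (complex ^ 'm) set"
  define \<tau> where "\<tau> = inv_into ?B \<psi>"
  have bij: "bij_betw \<psi> ?B ?B" and hol: "holomorphic_map_on \<psi> ?B" "holomorphic_map_on \<tau> ?B"
    using assms by (simp_all add: Aut_ball_def unit_ball_def \<tau>_def)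
  have im: "\<psi> ` ?B = ?B" "\<tau> ` ?B = ?B"
    using bij bij_betw_inv_into[OF bij] by (simp_all add: bij_betw_def \<tau>_def)
  have inv1: "\<psi> (\<tau> w) = w" and inv2: "\<tau> (\<psi> w) = w" if "w \<in> ?B" for w
    using bij that by (auto simp: \<tau>_def bij_betw_inv_into_left bij_betw_inv_into_right)
  define b where "b = \<tau> 0"
  have b: "norm b < 1" using im(2) by (force simp: b_def)
  have \<psi>b: "\<psi> b = 0" using inv1 by (simp add: b_def)
  have mB: "moebius b ` ?B \<subseteq> ?B" using moebius_in_ball[OF b] by auto
  have norm: "norm (\<psi> w) = norm (moebius b w)" if w: "norm w < 1" for w
  proof (rule antisym)
    have "norm (\<psi> (moebius b (moebius b w))) \<le> norm (moebius b w)"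
    proof (rule ball_Schwarz[where F = "\<lambda>w. \<psi> (moebius b w)"])
      show "holomorphic_map_on (\<lambda>w. \<psi> (moebius b w)) ?B"
        by (rule holomorphic_map_on_compose[OF moebius_holomorphic[OF b] hol(1) mB])
      show "(\<lambda>w. \<psi> (moebius b w)) ` ?B \<subseteq> ?B" using mB im(1) by blast
      show "\<psi> (moebius b 0) = 0" by (simp add: moebius_0 \<psi>b)
      show "norm (moebius b w) < 1" by (rule moebius_in_ball[OF b w])
    qed
    then show "norm (\<psi> w) \<le> norm (moebius b w)"
      by (simp add: moebius_involution[OF b w])
    have "norm (moebius b (\<tau> (\<psi> w))) \<le> norm (\<psi> w)"
    proof (rule ball_Schwarz[where F = "\<lambda>w. moebius b (\<tau> w)"])
      show "holomorphic_map_on (\<lambda>w. moebius b (\<tau> w)) ?B"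
        by (rule holomorphic_map_on_compose[OF hol(2) moebius_holomorphic[OF b]]) (simp add: im)
      show "(\<lambda>w. moebius b (\<tau> w)) ` ?B \<subseteq> ?B" using mB im(2) by blast
      show "moebius b (\<tau> 0) = 0" using moebius_self[OF b] by (simp add: b_def)
      show "norm (\<psi> w) < 1" using im(1) w by (metis image_eqI mem_ball_0)
    qed
    then show "norm (moebius b w) \<le> norm (\<psi> w)"
      using w by (simp add: inv2)
  qed
  show ?thesis
    using that[OF b] moebius_norm[OF b] norm by simp
qed

section \<open>Polarization and growth of polynomials along lines\<close>

definition entire_on_lines :: "(complex ^ 'n \<Rightarrow> complex) \<Rightarrow> bool"
  where "entire_on_lines F \<longleftrightarrow> (\<forall>p v. (\<lambda>l. F (p + l *s v)) holomorphic_on UNIV)"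

lemma entire_on_lines_one_minus_herm:
  assumes "\<And>i. entire_on_lines (\<lambda>z. F z $ i)"
  shows "entire_on_lines (\<lambda>z. 1 - herm (F z) b)"
  using assms unfolding entire_on_lines_def herm_def by (auto intro!: holomorphic_intros)

lemma entire_on_lines_cnj:
  assumes "entire_on_lines G"
  shows "(\<lambda>l. cnj (G (p + cnj l *s v))) holomorphic_on UNIV"
proof -
  have "cnj \<circ> (\<lambda>l. G (p + l *s v)) \<circ> cnj holomorphic_on UNIV"
    using assms unfolding entire_on_lines_def
    by (intro holomorphic_on_compose_cnj_cnj) (auto intro: holomorphic_on_subset)
  then show ?thesis by (simp add: o_def)
qed

lemma herm_holomorphic_on_lines:
  assumes "\<And>i. entire_on_lines (\<lambda>z. F z $ i)" "\<And>i. entire_on_lines (\<lambda>z. G z $ i)"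
  shows "(\<lambda>l. herm (F (p + l *s v)) (G (p + cnj l *s v))) holomorphic_on UNIV"
  unfolding herm_def using assms(1)
  by (intro holomorphic_intros entire_on_lines_cnj[OF assms(2)]) (auto simp: entire_on_lines_def)

lemma entire_eq_0_of_real_interval:
  fixes f :: "complex \<Rightarrow> complex"
  assumes "f holomorphic_on UNIV" "e > 0" "\<And>r. 0 < r \<Longrightarrow> r < e \<Longrightarrow> f (complex_of_real r) = 0"
  shows "f w = 0"
proof (rule analytic_continuation[OF assms(1) open_UNIV connected_UNIV])
  show "0 islimpt (complex_of_real ` {0<..<e})"
    unfolding islimpt_approachable
  proof (intro allI impI)
    fix d :: real assume "d > 0"
    then show "\<exists>x\<in>complex_of_real ` {0<..<e}. x \<noteq> 0 \<and> dist x 0 < d"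
      using \<open>e > 0\<close> by (intro bexI[of _ "complex_of_real (min d e / 2)"] imageI) (auto simp: min_def)
  qed
qed (use assms in auto)

text \<open>A kernel that is holomorphic in its first and antiholomorphic in its second argument is determined
  by its diagonal: along \<open>l \<mapsto> (p + l v, p + cnj l v)\<close> it is an entire function of \<open>l\<close>, and real \<open>l\<close>
  give points of the diagonal, while at \<open>l = \<i>\<close> a suitable choice of \<open>p\<close> and \<open>v\<close> reaches an arbitrary
  pair. The same argument along rays first extends the vanishing from the ball to the whole diagonal.\<close>

lemma polarization:
  fixes Q :: "complex ^ 'n \<Rightarrow> complex ^ 'n \<Rightarrow> complex"
  assumes hol: "\<And>p v. (\<lambda>l. Q (p + l *s v) (p + cnj l *s v)) holomorphic_on UNIV"
    and zero: "\<And>z. norm z < 1 \<Longrightarrow> Q z z = 0"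
  shows "Q z w = 0"
proof -
  have diag: "Q z z = 0" for z
  proof -
    have "Q (0 + 1 *s z) (0 + cnj 1 *s z) = 0"
    proof (rule entire_eq_0_of_real_interval[where f = "\<lambda>l. Q (0 + l *s z) (0 + cnj l *s z)", OF hol])
      show "0 < 1 / (1 + norm z)" by (simp add: add_pos_nonneg)
      fix r :: real assume "0 < r" "r < 1 / (1 + norm z)"
      then have "r * (1 + norm z) < 1"
        by (simp add: pos_less_divide_eq add_pos_nonneg)
      then have "norm (complex_of_real r *s z) < 1"
        using \<open>0 < r\<close> by (simp add: norm_complex_scale distrib_left)
      then show "Q (0 + complex_of_real r *s z) (0 + cnj (complex_of_real r) *s z) = 0"
        using zero by simp
    qed
    then show ?thesis by simp
  qed
  define p where "p = (1 / 2) *s (z + w)"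
  define v where "v = (- \<i> / 2) *s (z - w)"
  have "Q (p + \<i> *s v) (p + cnj \<i> *s v) = 0"
    by (rule entire_eq_0_of_real_interval[where f = "\<lambda>l. Q (p + l *s v) (p + cnj l *s v)"
          and e = 1, OF hol]) (simp_all add: diag)
  moreover have "p + \<i> *s v = z" "p + cnj \<i> *s v = w"
    by (simp_all add: p_def v_def vec_eq_iff algebra_simps)
  ultimately show ?thesis by simp
qed

text \<open>By homogeneity the quotient equals \<open>\<Sum>k\<le>D. m ^ (D - k) * h k (v + m *s p)\<close> with \<open>m = 1 / l\<close>, which
  is continuous at \<open>m = 0\<close>. The limit does not depend on the base point \<open>p\<close>.\<close>

lemma tendsto_leading_homogeneous_part:
  fixes h :: "nat \<Rightarrow> complex ^ 'n \<Rightarrow> complex"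
  assumes homog: "\<And>k c z. h k (c *s z) = c ^ k * h k z" and cont: "\<And>k. continuous_on UNIV (h k)"
  shows "((\<lambda>l. (\<Sum>k\<le>D. h k (p + l *s v)) / l ^ D) \<longlongrightarrow> h D v) at_infinity"
proof -
  let ?r = "\<lambda>m. \<Sum>k\<le>D. m ^ (D - k) * h k (v + m *s p)"
  have "continuous_on UNIV ?r"
    by (intro continuous_intros continuous_on_compose2[OF cont]
      bounded_bilinear.continuous_on[OF bounded_bilinear_complex_scale]) auto
  then have "(?r \<longlongrightarrow> ?r 0) (at 0)"
    unfolding continuous_on_def by blast
  moreover have "?r 0 = (\<Sum>k\<le>D. if k = D then h D v else 0)"
    by (intro sum.cong) auto
  ultimately have "(?r \<longlongrightarrow> h D v) (at 0)" by simp
  then have "((\<lambda>l. ?r (inverse l)) \<longlongrightarrow> h D v) at_infinity"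
    by (rule filterlim_compose)
      (auto simp: filterlim_at tendsto_inverse_0 eventually_not_equal_at_infinity)
  moreover have "\<forall>\<^sub>F l in at_infinity. ?r (inverse l) = (\<Sum>k\<le>D. h k (p + l *s v)) / l ^ D"
    using eventually_not_equal_at_infinity[of 0]
  proof eventually_elim
    case (elim l)
    have "inverse l ^ (D - k) * h k (v + inverse l *s p) = h k (p + l *s v) / l ^ D" if "k \<le> D" for k
    proof -
      have "p + l *s v = l *s (v + inverse l *s p)"
        using elim by (simp add: vec_eq_iff algebra_simps)
      then have "h k (p + l *s v) = l ^ k * h k (v + inverse l *s p)"
        by (simp only: homog)
      then show ?thesis
        using elim that by (simp add: power_diff divide_simps)
    qed
    then show ?case by (simp add: sum_divide_distrib)
  qed
  ultimately show ?thesis by (rule Lim_transform_eventually)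
qed

text \<open>A degree comparison: \<open>H\<close> and \<open>H \<circ> T\<close> have the same degree \<open>D\<close>, so nothing is left for \<open>g\<close>.
  Concretely, choose \<open>v\<close> such that the part of degree \<open>D\<close> of \<open>H\<close> does not vanish at \<open>T v\<close>. Along
  every line with direction \<open>v\<close>, the function \<open>g\<close> has at infinity the limit given by the quotient
  of the leading parts of \<open>\<kappa> H\<close> and \<open>H \<circ> T\<close>, and by Liouville's theorem it equals that limit. The limit depends on \<open>v\<close> only, hence \<open>g\<close> takes
  the same value on all these lines, and they fill the space.\<close>

lemma entire_cofactor_constant:
  fixes H g :: "complex ^ 'n \<Rightarrow> complex" and h :: "nat \<Rightarrow> complex ^ 'n \<Rightarrow> complex"
  assumes H: "\<And>z. H z = (\<Sum>k\<le>d. h k z)" and "H z0 \<noteq> 0"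
    and homog: "\<And>k c z. h k (c *s z) = c ^ k * h k z" and cont: "\<And>k. continuous_on UNIV (h k)"
    and T: "hermitian_isometry UNIV T"
    and g: "entire_on_lines g" and eq: "\<And>z. H (T z) * g z = \<kappa> * H z"
  shows "g p = g q"
proof -
  note TD = hermitian_isometryD[OF T]
  define D where "D = Max {k. k \<le> d \<and> (\<exists>z. h k z \<noteq> 0)}"
  have fin: "finite {k. k \<le> d \<and> (\<exists>z. h k z \<noteq> 0)}" by simp
  have "{k. k \<le> d \<and> (\<exists>z. h k z \<noteq> 0)} \<noteq> {}"
  proof
    assume "{k. k \<le> d \<and> (\<exists>z. h k z \<noteq> 0)} = {}"
    then have "h k z0 = 0" if "k \<le> d" for k
      using that by blast
    then show False using \<open>H z0 \<noteq> 0\<close> by (simp add: H)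
  qed
  from Max_in[OF fin this] obtain u where D: "D \<le> d" "h D u \<noteq> 0"
    unfolding D_def by blast
  have above: "h k z = 0" if "D < k" "k \<le> d" for k z
    using Max_ge[OF fin, of k] that unfolding D_def[symmetric] by force
  have HD: "H z = (\<Sum>k\<le>D. h k z)" for z
    unfolding H using D(1) above by (intro sum.mono_neutral_right) auto
  obtain v where v: "T v = u" using TD(6) by (metis UNIV_I imageE)
  have "g p = \<kappa> * h D v / h D u" for p
  proof -
    have lim: "((\<lambda>l. H (p + l *s v) / l ^ D) \<longlongrightarrow> h D v) at_infinity"
      "((\<lambda>l. H (T p + l *s u) / l ^ D) \<longlongrightarrow> h D u) at_infinity"
      unfolding HD by (rule tendsto_leading_homogeneous_part[OF homog cont])+
    have "\<forall>\<^sub>F l in at_infinity. \<kappa> * (H (p + l *s v) / l ^ D) / (H (T p + l *s u) / l ^ D) = g (p + l *s v)"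
      using eventually_not_equal_at_infinity[of 0] tendsto_imp_eventually_ne[OF lim(2) D(2)]
    proof eventually_elim
      case (elim l)
      then show ?case
        using eq[of "p + l *s v"] by (simp add: TD v field_simps)
    qed
    moreover have "((\<lambda>l. \<kappa> * (H (p + l *s v) / l ^ D) / (H (T p + l *s u) / l ^ D)) \<longlongrightarrow> \<kappa> * h D v / h D u) at_infinity"
      by (intro tendsto_intros lim D)
    ultimately have "((\<lambda>l. g (p + l *s v)) \<longlongrightarrow> \<kappa> * h D v / h D u) at_infinity"
      by (rule Lim_transform_eventually[rotated])
    then have "g (p + 0 *s v) = \<kappa> * h D v / h D u"
      using g unfolding entire_on_lines_def by (intro Liouville_weak) auto
    then show ?thesis by simp
  qed
  then show ?thesis by metis
qed

section \<open>Homogeneous parts of polynomial maps\<close>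

definition hom_part :: "(('n::finite \<Rightarrow> nat) \<Rightarrow>\<^sub>0 complex ^ 'N) \<Rightarrow> nat \<Rightarrow> complex ^ 'n \<Rightarrow> complex ^ 'N"
  where "hom_part P k z = (\<Sum>\<alpha> | \<alpha> \<in> Poly_Mapping.keys P \<and> mdeg \<alpha> = k.
    (\<Prod>i\<in>UNIV. z $ i ^ \<alpha> i) *s Poly_Mapping.lookup P \<alpha>)"

lemma hom_part_scale: "hom_part P k (c *s z) = c ^ k *s hom_part P k z"
  unfolding hom_part_def vec.scale_sum_right
  by (rule sum.cong) (auto simp: power_mult_distrib prod.distrib mdeg_def power_sum mult.assoc)

lemma continuous_on_hom_part: "continuous_on UNIV (hom_part P k)"
  unfolding hom_part_def
  by (intro continuous_intros bounded_bilinear.continuous_on[OF bounded_bilinear_complex_scale])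

lemma poly_map_eq_sum_hom_part:
  obtains d where "\<And>d' z. d \<le> d' \<Longrightarrow> poly_map P z = (\<Sum>k\<le>d'. hom_part P k z)"
proof
  fix d' z assume "Max (mdeg ` Poly_Mapping.keys P) \<le> d'"
  then have "mdeg ` Poly_Mapping.keys P \<subseteq> {..d'}"
    by (meson Max_ge atMost_iff finite_imageI finite_keys order_trans subsetI)
  then show "poly_map P z = (\<Sum>k\<le>d'. hom_part P k z)"
    unfolding poly_map_def hom_part_def by (intro sum.group[symmetric]) auto
qed

lemma entire_on_lines_poly_map: "entire_on_lines (\<lambda>z. poly_map P z $ i)"
  unfolding entire_on_lines_def poly_map_def by (auto intro!: holomorphic_intros)

text \<open>Induction on the set \<open>J\<close> of variables that occur: as a polynomial in one further variable, the sum
  vanishes coefficientwise, which fixes the exponent of that variable and leaves a polynomial in the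
  others. The coefficients of multi-indices that agree on \<open>J\<close> are only determined up to their sum,
  which is why the inductive statement sums over them.\<close>

lemma vanishing_polynomial_coeffs:
  fixes c :: "('n::finite \<Rightarrow> nat) \<Rightarrow> complex"
  assumes "finite K" "\<And>z. (\<Sum>\<alpha>\<in>K. c \<alpha> * (\<Prod>i\<in>UNIV. z i ^ \<alpha> i)) = 0" "\<alpha> \<in> K"
  shows "c \<alpha> = 0"
proof -
  have "(\<Sum>\<alpha> | \<alpha> \<in> K \<and> (\<forall>i\<in>J. \<alpha> i = \<beta> i). c \<alpha>) = 0"
    if "finite J" "finite K" "\<And>z. (\<Sum>\<alpha>\<in>K. c \<alpha> * (\<Prod>i\<in>J. z i ^ \<alpha> i)) = 0" for J K \<beta>
    using that
  proof (induction J arbitrary: K)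
    case empty
    then show ?case by simp
  next
    case (insert j J)
    let ?K = "{\<alpha>\<in>K. \<alpha> j = \<beta> j}"
    have "(\<Sum>\<alpha>\<in>?K. c \<alpha> * (\<Prod>i\<in>J. z i ^ \<alpha> i)) = 0" for z
    proof -
      \<comment> \<open>The summand \<open>\<beta> j\<close> ensures that the exponent of interest is among those compared, even
        if no multi-index in \<open>K\<close> has it.\<close>
      define M where "M = \<beta> j + Max ((\<lambda>\<alpha>. \<alpha> j) ` K)"
      define a where "a k = (\<Sum>\<alpha> | \<alpha> \<in> K \<and> \<alpha> j = k. c \<alpha> * (\<Prod>i\<in>J. z i ^ \<alpha> i))" for k
      have M: "(\<lambda>\<alpha>. \<alpha> j) ` K \<subseteq> {..M}"
        using insert.prems(1) by (auto simp: M_def intro: trans_le_add2)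
      have "(\<Sum>k\<le>M. a k * t ^ k) = 0" for t
      proof -
        have "(\<Sum>k\<le>M. a k * t ^ k) = (\<Sum>k\<le>M. \<Sum>\<alpha> | \<alpha> \<in> K \<and> \<alpha> j = k.
            c \<alpha> * (\<Prod>i\<in>J. z i ^ \<alpha> i) * t ^ \<alpha> j)"
          unfolding a_def sum_distrib_right by (intro sum.cong) auto
        also have "\<dots> = (\<Sum>\<alpha>\<in>K. c \<alpha> * (\<Prod>i\<in>J. z i ^ \<alpha> i) * t ^ \<alpha> j)"
          using insert.prems(1) M by (intro sum.group) auto
        also have "\<dots> = (\<Sum>\<alpha>\<in>K. c \<alpha> * (\<Prod>i\<in>insert j J. (z(j := t)) i ^ \<alpha> i))"
        proof (intro sum.cong refl)
          fix \<alpha>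
          have "(\<Prod>i\<in>J. (z(j := t)) i ^ \<alpha> i) = (\<Prod>i\<in>J. z i ^ \<alpha> i)"
            using insert.hyps by (intro prod.cong) auto
          then show "c \<alpha> * (\<Prod>i\<in>J. z i ^ \<alpha> i) * t ^ \<alpha> j = c \<alpha> * (\<Prod>i\<in>insert j J. (z(j := t)) i ^ \<alpha> i)"
            using insert.hyps by simp
        qed
        also have "\<dots> = 0" by (rule insert.prems(2))
        finally show ?thesis .
      qed
      then have "a (\<beta> j) = 0"
        using polyfun_eq_0[of a M] by (auto simp: M_def)
      then show ?thesis by (simp add: a_def)
    qed
    then have "(\<Sum>\<alpha> | \<alpha> \<in> ?K \<and> (\<forall>i\<in>J. \<alpha> i = \<beta> i). c \<alpha>) = 0"
      using insert.prems(1) by (intro insert.IH) auto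
    moreover have "{\<alpha>. \<alpha> \<in> ?K \<and> (\<forall>i\<in>J. \<alpha> i = \<beta> i)} = {\<alpha>. \<alpha> \<in> K \<and> (\<forall>i\<in>insert j J. \<alpha> i = \<beta> i)}"
      by auto
    ultimately show ?case by simp
  qed
  from this[of UNIV K \<alpha>] have "(\<Sum>\<gamma> | \<gamma> \<in> K \<and> (\<forall>i\<in>UNIV. \<gamma> i = \<alpha> i). c \<gamma>) = 0"
    using assms by simp
  moreover have "{\<gamma>. \<gamma> \<in> K \<and> (\<forall>i\<in>UNIV. \<gamma> i = \<alpha> i)} = {\<alpha>}"
    using assms(3) by (auto simp: fun_eq_iff)
  ultimately show ?thesis by simp
qed

lemma in_subspace_if_orthogonal_to_orth_compl:
  assumes "vec.subspace S" "\<And>w. w \<in> orth_compl S \<Longrightarrow> herm x w = 0"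
  shows "x \<in> S"
proof -
  obtain y where y: "y \<in> S" "x - y \<in> orth_compl S"
    using orth_proj_unique[OF assms(1)] by blast
  have "herm (x - y) y = 0" using y by (simp add: orth_compl_def)
  then have "herm y (x - y) = 0" by (metis herm_cnj complex_cnj_zero)
  then have "herm (x - y) (x - y) = 0"
    using assms(2)[OF y(2)] by (simp add: herm_diff_left)
  then show ?thesis using y(1) by (simp add: herm_self_eq_0_iff)
qed

text \<open>For the nontrivial inclusion, a vector orthogonal to all values of a homogeneous part turns it into
  a scalar polynomial that vanishes identically, so it is orthogonal to all coefficients.
  Describing the space of coefficients by values makes the effect of substitutions \<open>z \<mapsto> T z\<close> visible,
  under which single coefficients mix.\<close>

lemma span_coeffs_eq_span_values:
  fixes P :: "('n::finite \<Rightarrow> nat) \<Rightarrow>\<^sub>0 complex ^ 'N"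
  shows "vec.span (Poly_Mapping.lookup P ` {\<alpha>. mdeg \<alpha> = k}) = vec.span (range (hom_part P k))"
proof (rule vec.span_eq[THEN iffD2], intro conjI image_subsetI)
  fix \<alpha> :: "'n \<Rightarrow> nat" assume "\<alpha> \<in> {\<alpha>. mdeg \<alpha> = k}"
  then have \<alpha>: "mdeg \<alpha> = k" by simp
  show "Poly_Mapping.lookup P \<alpha> \<in> vec.span (range (hom_part P k))"
  proof (rule in_subspace_if_orthogonal_to_orth_compl)
    fix w assume w: "w \<in> orth_compl (vec.span (range (hom_part P k)))"
    have "herm (Poly_Mapping.lookup P \<alpha>) w = 0" if "\<alpha> \<in> Poly_Mapping.keys P"
    proof (rule vanishing_polynomial_coeffs)
      show "finite {\<alpha> \<in> Poly_Mapping.keys P. mdeg \<alpha> = k}" by simp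
      show "\<alpha> \<in> {\<alpha> \<in> Poly_Mapping.keys P. mdeg \<alpha> = k}" using that \<alpha> by simp
      fix z :: "'n \<Rightarrow> complex"
      have "herm w (hom_part P k (\<chi> i. z i)) = 0"
        using w vec.span_base[of "hom_part P k (\<chi> i. z i)" "range (hom_part P k)"]
        by (simp add: orth_compl_def)
      then have "herm (hom_part P k (\<chi> i. z i)) w = 0" by (metis herm_cnj complex_cnj_zero)
      then show "(\<Sum>\<alpha> | \<alpha> \<in> Poly_Mapping.keys P \<and> mdeg \<alpha> = k.
          herm (Poly_Mapping.lookup P \<alpha>) w * (\<Prod>i\<in>UNIV. z i ^ \<alpha> i)) = 0"
        by (simp add: hom_part_def herm_sum_left herm_scale_left mult.commute)
    qed
    then show "herm (Poly_Mapping.lookup P \<alpha>) w = 0"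
      by (cases "\<alpha> \<in> Poly_Mapping.keys P") (simp_all add: in_keys_iff)
  qed simp
next
  show "hom_part P k z \<in> vec.span (Poly_Mapping.lookup P ` {\<alpha>. mdeg \<alpha> = k})" for z
    unfolding hom_part_def by (intro vec.span_sum vec.span_scale vec.span_base) auto
qed

section \<open>Unitary symmetries of polynomial maps\<close>

text \<open>The automorphism \<open>\<psi>\<close> enters only through its norm identity, whose factor \<open>|1 - \<langle>w, b\<rangle>|\<^sup>2\<close>
  becomes \<open>|g|\<^sup>2\<close> at \<open>w = f(z)\<close>, with \<open>g = 1 - \<langle>f, b\<rangle>\<close>. Polarization followed by the
  degree comparison shows that \<open>g\<close> is constant. Since \<open>T\<close> fixes the origin, the value at \<open>0\<close> then determines the constant.\<close>

lemma poly_map_Gram_invariant: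
  fixes f :: "complex ^ 'n \<Rightarrow> complex ^ 'N"
  assumes f: "f = poly_map P" and ball: "\<And>z. norm z < 1 \<Longrightarrow> norm (f z) < 1"
    and T: "hermitian_isometry UNIV T" and \<psi>: "\<psi> \<in> Aut_ball UNIV"
    and fT: "\<And>z. norm z < 1 \<Longrightarrow> f (T z) = \<psi> (f z)"
  shows "herm (f (T z)) (f (T w)) = herm (f z) (f w)"
proof -
  note TD = hermitian_isometryD[OF T]
  obtain b where b: "norm b < 1" and id: "\<And>w. norm w < 1 \<Longrightarrow>
    (1 - (norm (\<psi> w))\<^sup>2) * (cmod (1 - herm w b))\<^sup>2 = (1 - (norm b)\<^sup>2) * (1 - (norm w)\<^sup>2)"
    using Aut_ball_norm_identity[OF \<psi>] by blast
  define g where "g z = 1 - herm (f z) b" for z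
  define c where "c = complex_of_real (1 - (norm b)\<^sup>2)"
  have lines: "entire_on_lines (\<lambda>z. f z $ i)" "entire_on_lines (\<lambda>z. f (T z) $ i)" for i
    using entire_on_lines_poly_map[of P i] by (simp_all add: f entire_on_lines_def TD)
  have g: "entire_on_lines g"
    unfolding g_def by (rule entire_on_lines_one_minus_herm[OF lines(1)])
  have "(1 - herm (f (T z)) (f (T w))) * (g z * cnj (g w)) - c * (1 - herm (f z) (f w)) = 0" for z w
  proof (rule polarization[where Q = "\<lambda>z w. (1 - herm (f (T z)) (f (T w))) * (g z * cnj (g w))
      - c * (1 - herm (f z) (f w))"])
    show "(\<lambda>l. (1 - herm (f (T (p + l *s v))) (f (T (p + cnj l *s v)))) *
        (g (p + l *s v) * cnj (g (p + cnj l *s v))) -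
        c * (1 - herm (f (p + l *s v)) (f (p + cnj l *s v)))) holomorphic_on UNIV" for p v
      using g by (intro holomorphic_intros entire_on_lines_cnj[OF g]
          herm_holomorphic_on_lines[where F = f] herm_holomorphic_on_lines[where F = "\<lambda>z. f (T z)"]
          lines) (auto simp: entire_on_lines_def)
    fix z :: "complex ^ 'n" assume z: "norm z < 1"
    have "complex_of_real ((1 - (norm (f (T z)))\<^sup>2) * (cmod (g z))\<^sup>2) = c * (1 - herm (f z) (f z))"
      by (simp only: fT[OF z] g_def c_def herm_self id[OF ball[OF z]]) simp
    then show "(1 - herm (f (T z)) (f (T z))) * (g z * cnj (g z)) - c * (1 - herm (f z) (f z)) = 0"
      by (simp add: herm_self complex_norm_square[symmetric])
  qed
  then have eq: "(1 - herm (f (T z)) (f (T w))) * (g z * cnj (g w)) = c * (1 - herm (f z) (f w))" for z w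
    by simp
  have f0: "1 - herm (f 0) (f 0) \<noteq> 0"
    using one_minus_herm_nonzero[OF ball ball] by simp
  have "g z = g 0" for z
  proof -
    obtain d where d: "\<And>d' z. d \<le> d' \<Longrightarrow> poly_map P z = (\<Sum>k\<le>d'. hom_part P k z)"
      using poly_map_eq_sum_hom_part by blast
    \<comment> \<open>The homogeneous parts of \<open>1 - \<langle>f, f(0)\<rangle>\<close>; the summand \<open>1\<close> has degree \<open>0\<close>.\<close>
    define h where "h k z = (if k = 0 then 1 else 0) - herm (hom_part P k z) (f 0)" for k z
    have h_sum: "1 - herm (f z) (f 0) = (\<Sum>k\<le>d. h k z)" for z
      by (simp add: f d[OF order_refl] h_def sum_subtractf herm_sum_left)
    have "g 0 \<noteq> 0"
      using one_minus_herm_nonzero[OF b ball] by (simp add: g_def)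
    then have eq0: "(1 - herm (f (T z)) (f 0)) * g z = c / cnj (g 0) * (1 - herm (f z) (f 0))" for z
      using eq[of z 0] by (simp add: TD field_simps)
    show ?thesis
    proof (rule entire_cofactor_constant[OF h_sum f0 _ _ T g eq0])
      show "h k (c *s z) = c ^ k * h k z" for k c z
        by (simp add: h_def hom_part_scale herm_scale_left)
      show "continuous_on UNIV (h k)" for k
        unfolding h_def
        by (intro continuous_intros continuous_on_hom_part
            bounded_linear.continuous_on[OF bounded_linear_herm_left])
    qed
  qed
  then have eq: "(1 - herm (f (T z)) (f (T w))) * (g 0 * cnj (g 0)) = c * (1 - herm (f z) (f w))" for z w
    using eq[of z w] by metis
  moreover have "c = g 0 * cnj (g 0)"
    using eq[of 0 0] f0 by (simp add: TD)
  moreover have "c \<noteq> 0"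
    using b by (simp add: c_def abs_square_eq_1 flip: of_real_power)
  ultimately show ?thesis by (metis diff_left_imp_eq mult.commute mult_left_cancel)
qed

text \<open>Both sides of \<open>V (f (t z)) = f (T (t z))\<close> are polynomials in \<open>t\<close>; their coefficients are
  the homogeneous parts.\<close>

lemma hom_part_symmetry:
  assumes T: "hermitian_isometry UNIV T" and V: "hermitian_isometry UNIV V"
    and eq: "\<And>z. V (poly_map P z) = poly_map P (T z)"
  shows "V (hom_part P k z) = hom_part P k (T z)"
proof -
  note L = V[unfolded hermitian_isometry_def, THEN conjunct1]
  obtain d where d: "\<And>d' z. d \<le> d' \<Longrightarrow> poly_map P z = (\<Sum>k\<le>d'. hom_part P k z)"
    using poly_map_eq_sum_hom_part by blast
  have "(V (hom_part P k z) - hom_part P k (T z)) $ i = 0" for i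
  proof -
    have "(\<Sum>j\<le>max d k. (V (hom_part P j z) - hom_part P j (T z)) $ i * t ^ j) = 0" for t
    proof -
      have "(\<Sum>j\<le>max d k. t ^ j *s V (hom_part P j z)) = V (poly_map P (t *s z))"
        by (simp add: d[of "max d k"] vec.linear_sum[OF L] vec.linear_scale[OF L] hom_part_scale)
      also have "\<dots> = poly_map P (T (t *s z))" by (rule eq)
      also have "\<dots> = (\<Sum>j\<le>max d k. t ^ j *s hom_part P j (T z))"
        by (simp add: hermitian_isometryD(2)[OF T] d[of "max d k"] hom_part_scale)
      finally have "(\<Sum>j\<le>max d k. t ^ j *s V (hom_part P j z)) $ i
          = (\<Sum>j\<le>max d k. t ^ j *s hom_part P j (T z)) $ i"
        by simp
      then show ?thesis
        by (simp add: sum_subtractf algebra_simps)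
    qed
    then show ?thesis
      using polyfun_eq_0[of "\<lambda>j. (V (hom_part P j z) - hom_part P j (T z)) $ i" "max d k"]
      by (meson max.cobounded2)
  qed
  then show ?thesis by (simp add: vec_eq_iff)
qed

section \<open>Projections and the tensor operation\<close>

lemma orth_proj_props:
  assumes "vec.subspace A"
  shows "orth_proj A x \<in> A" "x - orth_proj A x \<in> orth_compl A"
  using theI'[OF orth_proj_unique[OF assms, of x]] by (simp_all add: orth_proj_def)

lemma orth_proj_commutes_isometry:
  assumes A: "vec.subspace A" and V: "hermitian_isometry A V"
  shows "orth_proj A (V x) = V (orth_proj A x)"
proof -
  note D = hermitian_isometryD[OF V]
  have "V (orth_proj A x) \<in> A"
    using orth_proj_props(1)[OF A] D(6) by blast
  moreover have "herm (V x - V (orth_proj A x)) a = 0" if "a \<in> A" for a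
  proof -
    obtain a' where "a = V a'" "a' \<in> A" using \<open>a \<in> A\<close> D(6) by blast
    then show ?thesis
      using orth_proj_props(2)[OF A, of x] by (simp add: D orth_compl_def flip: D(3))
  qed
  ultimately show ?thesis
    using orth_proj_unique[OF A, of "V x"] orth_proj_props[OF A, of "V x"]
    by (auto simp: orth_compl_def)
qed

lemma subspace_tensor_target: "vec.subspace (tensor_target A)"
proof -
  have sum: "direct_sum x y + direct_sum x' y' = direct_sum (x + x') (y + y')"
    "c *s direct_sum x y = direct_sum (c *s x) (c *s y)" "direct_sum 0 0 = 0" for c x y x' y'
    by (auto simp: direct_sum_def vec_eq_iff split: sum.split)
  have O: "vec.subspace (orth_compl A)"
    by (rule vec.subspaceI) (auto simp: orth_compl_def herm_add_left herm_scale_left)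
  show ?thesis
  proof (rule vec.subspaceI)
    show "0 \<in> tensor_target A"
      unfolding tensor_target_def using vec.span_zero vec.subspace_0[OF O] sum(3)[symmetric] by blast
    show "x + y \<in> tensor_target A" if "x \<in> tensor_target A" "y \<in> tensor_target A" for x y
      using that unfolding tensor_target_def
      by (clarsimp simp: sum) (use vec.span_add vec.subspace_add[OF O] in blast)
    show "c *s x \<in> tensor_target A" if "x \<in> tensor_target A" for c x
      using that unfolding tensor_target_def
      by (clarsimp simp: sum) (use vec.span_scale vec.subspace_scale[OF O] in blast)
  qed
qed

lemma herm_tensor_op:
  "herm (tensor_op A f z) (tensor_op A f w) =
    herm (orth_proj A (f z)) (orth_proj A (f w)) * herm z w +
    herm (f z - orth_proj A (f z)) (f w - orth_proj A (f w))"
  by (simp add: tensor_op_def herm_direct_sum herm_tensor)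

text \<open>By Pythagoras \<open>|f(z)|\<^sup>2\<close> is the sum of the squares of its two components, and tensoring with \<open>z\<close>
  multiplies the first one by \<open>|z|\<^sup>2\<close>. Thus \<open>Ef\<close> maps the ball to the ball whenever \<open>f\<close> does.\<close>

lemma norm_tensor_op_le:
  assumes A: "vec.subspace A" and z: "norm z \<le> 1"
  shows "norm (tensor_op A f z) \<le> norm (f z)"
proof -
  let ?p = "orth_proj A (f z)" and ?q = "f z - orth_proj A (f z)"
  have qp: "herm ?q ?p = 0"
    using orth_proj_props[OF A, of "f z"] by (simp add: orth_compl_def)
  then have "herm ?p ?q = 0" by (metis herm_cnj complex_cnj_zero)
  then have "herm (?p + ?q) (?p + ?q) = herm ?p ?p + herm ?q ?q"
    using qp by (simp only: herm_add_left herm_add_right) simp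
  then have "complex_of_real ((norm (f z))\<^sup>2) = of_real ((norm ?p)\<^sup>2 + (norm ?q)\<^sup>2)"
    by (simp add: herm_self)
  then have f: "(norm (f z))\<^sup>2 = (norm ?p)\<^sup>2 + (norm ?q)\<^sup>2"
    by (simp only: of_real_eq_iff)
  have "complex_of_real ((norm (tensor_op A f z))\<^sup>2) = of_real ((norm ?p)\<^sup>2 * (norm z)\<^sup>2 + (norm ?q)\<^sup>2)"
    using herm_tensor_op[of A f z z] by (simp add: herm_self)
  then have "(norm (tensor_op A f z))\<^sup>2 = (norm ?p)\<^sup>2 * (norm z)\<^sup>2 + (norm ?q)\<^sup>2"
    by (simp only: of_real_eq_iff)
  also have "\<dots> \<le> (norm (f z))\<^sup>2"
    unfolding f using z by (simp add: mult_left_le power_le_one)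
  finally show ?thesis by (simp add: power2_le_iff_abs_le)
qed

lemma unitary_matrix_isometry:
  assumes U: "unitary_matrix U"
  shows "hermitian_isometry UNIV ((*v) U)"
proof -
  have "U *v (conj_transpose U *v x) = x" for x
    using U by (simp add: matrix_vector_mul_assoc unitary_matrix_def)
  then have "surj ((*v) U)" by (metis surjI)
  then show ?thesis
    by (simp add: hermitian_isometry_def herm_unitary[OF U])
qed

theorem theorem4p1:
  fixes P :: "('n::finite \<Rightarrow> nat) \<Rightarrow>\<^sub>0 complex ^ 'N"
    and f :: "complex ^ 'n \<Rightarrow> complex ^ 'N"
    and A :: "(complex ^ 'N) set"
  assumes "f = poly_map P"
    and "proper_map (top_of_set (unit_ball UNIV)) (top_of_set (unit_ball UNIV)) f"
    and "A = lowest_order_space P"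
  shows "hermitian_group UNIV f \<inter> unitary_group
    \<subseteq> hermitian_group (tensor_target A) (tensor_op A f)"
proof
  fix \<gamma> :: "complex ^ 'n \<Rightarrow> complex ^ 'n"
  assume \<gamma>: "\<gamma> \<in> hermitian_group UNIV f \<inter> unitary_group"
  have ball: "norm (f z) < 1" if "norm z < 1" for z
    using proper_map_imp_subset_topspace[OF assms(2)] that by (auto simp: unit_ball_def)
  obtain U where U: "unitary_matrix U" and \<gamma>U: "\<gamma> = restrict ((*v) U) (unit_ball UNIV)"
    using \<gamma> by (auto simp: unitary_group_def)
  define T where "T = (*v) U"
  have T: "hermitian_isometry UNIV T"
    unfolding T_def by (rule unitary_matrix_isometry[OF U])
  note TD = hermitian_isometryD[OF T]
  have \<gamma>T: "\<gamma> z = T z" if "norm z < 1" for z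
    using that by (simp add: \<gamma>U T_def unit_ball_def)
  obtain \<psi> where \<psi>: "\<psi> \<in> Aut_ball UNIV" "\<And>z. norm z < 1 \<Longrightarrow> f (\<gamma> z) = \<psi> (f z)"
    using \<gamma> by (auto simp: hermitian_group_def unit_ball_def)
  have gram: "herm (f (T z)) (f (T w)) = herm (f z) (f w)" for z w
    by (rule poly_map_Gram_invariant[OF assms(1) ball T \<psi>(1)]) (simp_all add: \<psi>(2) flip: \<gamma>T)
  obtain V where V: "hermitian_isometry UNIV V" "\<And>z. V (f z) = f (T z)"
    using isometry_of_equal_Gram[of UNIV f "\<lambda>z. f (T z)"] gram by auto
  note VD = hermitian_isometryD[OF V(1)]
  have A: "A = vec.span (range (hom_part P (lowest_order P)))"
    unfolding assms(3) lowest_order_space_def by (rule span_coeffs_eq_span_values)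
  then have subA: "vec.subspace A" by simp
  have "V ` range (hom_part P (lowest_order P)) = range (hom_part P (lowest_order P) \<circ> T)"
    using hom_part_symmetry[OF T V(1)] V(2) by (auto simp: assms(1) image_comp o_def)
  also have "\<dots> = range (hom_part P (lowest_order P))"
    by (simp only: image_comp[symmetric] TD)
  finally have "V ` A = A"
    unfolding A using V(1) by (simp add: hermitian_isometry_def vec.linear_span_image[symmetric])
  then have VA: "hermitian_isometry A V"
    using V(1) by (simp add: hermitian_isometry_def)
  have "herm (tensor_op A f z) (tensor_op A f w) =
      herm (tensor_op A f (T z)) (tensor_op A f (T w))" for z w
    by (simp only: herm_tensor_op orth_proj_commutes_isometry[OF subA VA] V(2)[symmetric]
        VD(3)[symmetric] VD(5) TD(5))
  then obtain S where S: "hermitian_isometry (tensor_target A) S"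
    "\<And>z. S (tensor_op A f z) = tensor_op A f (T z)"
    using isometry_of_equal_Gram[OF subspace_tensor_target,
        of "tensor_op A f" A "\<lambda>z. tensor_op A f (T z)"]
      tensor_op_in_target[OF subA] by metis
  have "tensor_op A f z \<in> unit_ball (tensor_target A)" if "norm z < 1" for z
    using norm_tensor_op_le[OF subA, of z f] ball[OF that] that tensor_op_in_target[OF subA]
    by (simp add: unit_ball_def)
  then have "tensor_op A f (\<gamma> z) = restrict S (unit_ball (tensor_target A)) (tensor_op A f z)"
    if "z \<in> unit_ball UNIV" for z
    using that by (simp add: \<gamma>T S(2) unit_ball_def)
  then have "\<exists>\<psi>\<in>Aut_ball (tensor_target A). \<forall>z\<in>unit_ball UNIV. tensor_op A f (\<gamma> z) = \<psi> (tensor_op A f z)"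
    using hermitian_isometry_in_Aut_ball[OF S(1)] by blast
  moreover have "\<gamma> \<in> Aut_ball UNIV"
    using \<gamma> by (simp add: hermitian_group_def)
  ultimately show "\<gamma> \<in> hermitian_group (tensor_target A) (tensor_op A f)"
    by (simp add: hermitian_group_def)
qed

end
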